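(* Let $\varepsilon=(\varepsilon_i)_{i\in I}$ with $\varepsilon_i>0$ for all $i\in I$, and let $\varepsilon_{\hat I}=(\varepsilon_i)_{i\in\hat I}$. Then: (1) $\breve P^+(\varepsilon_{\hat I})=\hat P^+(\varepsilon)$; (2) $\pi_i(p)=\hat\pi_i(p,\varepsilon_i)$ for all $p\in\hat P^+(\varepsilon)$ and all $i\in\breve I$; (3) $\breve\nu^D(\varepsilon_{\hat I})=\hat\nu^D(\varepsilon)$.
   Context: Market data: $I=\{1,\dots,|I|\}$ is a finite nonempty set of generating units; for each $i\in I$: $g_i^{\max}>0$, $w_i\ge 0$, and $c_i:[0,g_i^{\max}]\to\mathbb{R}$ is a non-decreasing convex continuous function with $c_i(0)=0$. The demand $d$ is a fixed real number with $0\le d\le\sum_{i\in I}g_i^{\max}$. For $x_i=(u_i,g_i)$ the cost is $C_i(x_i)=c_i(g_i)+w_iu_i$, and the private feasible set is $X_i=\{(u_i,g_i): u_i\in\{0,1\},\ g_i\in\mathbb{R},\ 0\le g_i\le u_ig_i^{\max}\}$. Minimum economic output $g_i^{ec.\min}$: if $w_i=0$, then $g_i^{ec.\min}=0$; if $w_i\ne0$, then $g_i^{ec.\min}$ is the lowest $g\in(0,g_i^{\max})$ satisfying $[w_i+c_i(g)]/g\in\partial c_i(g)$ (subdifferential), and $g_i^{ec.\min}=g_i^{\max}$ if there is no such $g$. Let $\bar g_i^{\max}=\min(d;g_i^{\max})$. The set $I$ is partitioned into $\breve I=\{i\in I: g_i^{ec.\min}\le\bar g_i^{\max}\}$ and $\hat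 I=\{i\in I: g_i^{ec.\min}>\bar g_i^{\max}\}$. For $p\in\mathbb{R}$ and $\varepsilon_i>0$: $\hat X_i(\varepsilon_i)=\{(u_i,g_i)\in X_i: g_i\le\bar g_i^{\max}+\varepsilon_i\}$, $\pi_i(p)=\max_{x_i\in X_i}[pg_i-C_i(x_i)]$, $\hat\pi_i(p,\varepsilon_i)=\max_{x_i\in\hat X_i(\varepsilon_i)}[pg_i-C_i(x_i)]$. Define $\hat\nu^D(\varepsilon)=\max_{p\in\mathbb{R}}[pd-\sum_{i\in I}\hat\pi_i(p,\varepsilon_i)]$ with set of maximizers $\hat P^+(\varepsilon)$, and $\breve\nu^D(\varepsilon_{\hat I})=\max_{p\in\mathbb{R}}[pd-\sum_{i\in\breve I}\pi_i(p)-\sum_{i\in\hat I}\hat\pi_i(p,\varepsilon_i)]$ with set of maximizers $\breve P^+(\varepsilon_{\hat I})$. *)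

theory Defs
  imports "HOL-Analysis.Analysis"
begin

section \<open>A single generating unit\<close>

text \<open>A decision of a unit is a pair \<open>x = (u, g)\<close> of commitment status and output.\<close>

definition unit_cost :: "(real \<Rightarrow> real) \<Rightarrow> real \<Rightarrow> real \<times> real \<Rightarrow> real" where
  "unit_cost c w = (\<lambda>(u, g). c g + w * u)"

definition feasible :: "real \<Rightarrow> (real \<times> real) set" where
  "feasible gmax = {(u, g). u \<in> {0, 1} \<and> 0 \<le> g \<and> g \<le> u * gmax}"

definition gbar :: "real \<Rightarrow> real \<Rightarrow> real" where
  "gbar d gmax = min d gmax"

definition feasible_hat :: "real \<Rightarrow> real \<Rightarrow> real \<Rightarrow> (real \<times> real) set" where
  "feasible_hat d gmax e = {(u, g) \<in> feasible gmax. g \<le> gbar d gmax + e}"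

text \<open>Subdifferential at \<open>x\<close> of a convex function whose effective domain is \<open>S\<close>
  (that is, the function is \<open>+\<infinity>\<close> outside \<open>S\<close>).\<close>

definition subdifferential :: "real set \<Rightarrow> (real \<Rightarrow> real) \<Rightarrow> real \<Rightarrow> real set" where
  "subdifferential S f x = {s. \<forall>y\<in>S. f x + s * (y - x) \<le> f y}"

definition is_ec_output :: "(real \<Rightarrow> real) \<Rightarrow> real \<Rightarrow> real \<Rightarrow> real \<Rightarrow> bool" where
  "is_ec_output c w gmax g \<longleftrightarrow>
     g \<in> {0<..<gmax} \<and> (w + c g) / g \<in> subdifferential {0..gmax} c g"

text \<open>For the admissible data (\<open>w > 0\<close>, \<open>c\<close> convex and continuous on \<open>{0..gmax}\<close>) the set of
  outputs satisfying \<open>is_ec_output\<close> has a least element as soon as it is nonempty, so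
  \<open>LEAST\<close> is meaningful whenever it is used.\<close>

definition ec_min :: "(real \<Rightarrow> real) \<Rightarrow> real \<Rightarrow> real \<Rightarrow> real" where
  "ec_min c w gmax =
     (if w = 0 then 0
      else if \<exists>g. is_ec_output c w gmax g then (LEAST g. is_ec_output c w gmax g)
      else gmax)"

text \<open>The suprema below are attained, see \<open>profit_attained\<close> and \<open>profit_hat_attained\<close>.\<close>

definition profit :: "(real \<Rightarrow> real) \<Rightarrow> real \<Rightarrow> real \<Rightarrow> real \<Rightarrow> real" where
  "profit c w gmax p = (SUP (u, g)\<in>feasible gmax. p * g - unit_cost c w (u, g))"

definition profit_hat ::
    "(real \<Rightarrow> real) \<Rightarrow> real \<Rightarrow> real \<Rightarrow> real \<Rightarrow> real \<Rightarrow> real \<Rightarrow> real" where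
  "profit_hat c w gmax d p e =
     (SUP (u, g)\<in>feasible_hat d gmax e. p * g - unit_cost c w (u, g))"


section \<open>The market\<close>

definition breve_units ::
    "'i set \<Rightarrow> ('i \<Rightarrow> real) \<Rightarrow> ('i \<Rightarrow> real) \<Rightarrow> ('i \<Rightarrow> real \<Rightarrow> real) \<Rightarrow> real \<Rightarrow> 'i set" where
  "breve_units I gmax w c d =
     {i \<in> I. ec_min (c i) (w i) (gmax i) \<le> gbar d (gmax i)}"

definition hat_units ::
    "'i set \<Rightarrow> ('i \<Rightarrow> real) \<Rightarrow> ('i \<Rightarrow> real) \<Rightarrow> ('i \<Rightarrow> real \<Rightarrow> real) \<Rightarrow> real \<Rightarrow> 'i set" where
  "hat_units I gmax w c d =
     {i \<in> I. ec_min (c i) (w i) (gmax i) > gbar d (gmax i)}"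

definition dual_hat ::
    "'i set \<Rightarrow> ('i \<Rightarrow> real) \<Rightarrow> ('i \<Rightarrow> real) \<Rightarrow> ('i \<Rightarrow> real \<Rightarrow> real) \<Rightarrow> real
      \<Rightarrow> ('i \<Rightarrow> real) \<Rightarrow> real \<Rightarrow> real" where
  "dual_hat I gmax w c d \<epsilon> p =
     p * d - (\<Sum>i\<in>I. profit_hat (c i) (w i) (gmax i) d p (\<epsilon> i))"

definition dual_breve ::
    "'i set \<Rightarrow> ('i \<Rightarrow> real) \<Rightarrow> ('i \<Rightarrow> real) \<Rightarrow> ('i \<Rightarrow> real \<Rightarrow> real) \<Rightarrow> real
      \<Rightarrow> ('i \<Rightarrow> real) \<Rightarrow> real \<Rightarrow> real" where
  "dual_breve I gmax w c d \<epsilon> p =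
     p * d - (\<Sum>i\<in>breve_units I gmax w c d. profit (c i) (w i) (gmax i) p)
           - (\<Sum>i\<in>hat_units I gmax w c d. profit_hat (c i) (w i) (gmax i) d p (\<epsilon> i))"

definition maximizers :: "(real \<Rightarrow> real) \<Rightarrow> real set" where
  "maximizers f = {p. \<forall>q. f q \<le> f p}"

text \<open>The optimal values are suprema over all prices: they are the maxima whenever a maximizer
  exists (\<open>maximizers_SUP\<close>), and stay meaningful in the degenerate case where the demand equals
  the total capacity and a cost function has infinite slope at full output, in which the maximum
  need not be attained.\<close>

definition nu_hat ::
    "'i set \<Rightarrow> ('i \<Rightarrow> real) \<Rightarrow> ('i \<Rightarrow> real) \<Rightarrow> ('i \<Rightarrow> real \<Rightarrow> real) \<Rightarrow> real
      \<Rightarrow> ('i \<Rightarrow> real) \<Rightarrow> real" where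
  "nu_hat I gmax w c d \<epsilon> = (SUP p. dual_hat I gmax w c d \<epsilon> p)"

definition P_hat ::
    "'i set \<Rightarrow> ('i \<Rightarrow> real) \<Rightarrow> ('i \<Rightarrow> real) \<Rightarrow> ('i \<Rightarrow> real \<Rightarrow> real) \<Rightarrow> real
      \<Rightarrow> ('i \<Rightarrow> real) \<Rightarrow> real set" where
  "P_hat I gmax w c d \<epsilon> = maximizers (dual_hat I gmax w c d \<epsilon>)"

definition nu_breve ::
    "'i set \<Rightarrow> ('i \<Rightarrow> real) \<Rightarrow> ('i \<Rightarrow> real) \<Rightarrow> ('i \<Rightarrow> real \<Rightarrow> real) \<Rightarrow> real
      \<Rightarrow> ('i \<Rightarrow> real) \<Rightarrow> real" where
  "nu_breve I gmax w c d \<epsilon> = (SUP p. dual_breve I gmax w c d \<epsilon> p)"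

definition P_breve ::
    "'i set \<Rightarrow> ('i \<Rightarrow> real) \<Rightarrow> ('i \<Rightarrow> real) \<Rightarrow> ('i \<Rightarrow> real \<Rightarrow> real) \<Rightarrow> real
      \<Rightarrow> ('i \<Rightarrow> real) \<Rightarrow> real set" where
  "P_breve I gmax w c d \<epsilon> = maximizers (dual_breve I gmax w c d \<epsilon>)"


section \<open>The suprema are maxima\<close>

lemma maximizers_SUP:
  assumes "p \<in> maximizers f"
  shows "(SUP q. f q) = f p"
  using assms unfolding maximizers_def by (intro cSup_eq_maximum) auto

lemma sup_attained:
  fixes c :: "real \<Rightarrow> real"
  assumes "0 \<le> b" and cont: "continuous_on {0..b} c"
    and X: "X = insert (0, 0) ({1} \<times> {0..b})"
  shows "\<exists>x\<in>X. (SUP (u, g)\<in>X. p * g - unit_cost c w (u, g)) = p * snd x - unit_cost c w x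
           \<and> (\<forall>y\<in>X. p * snd y - unit_cost c w y \<le> p * snd x - unit_cost c w x)"
proof -
  let ?f = "\<lambda>x. p * snd x - unit_cost c w x"
  have "compact X" "X \<noteq> {}"
    unfolding X by (auto intro!: compact_insert compact_Times simp del: insert_Times_insert)
  moreover have "continuous_on X (\<lambda>x. c (snd x))"
    by (rule continuous_on_compose2[OF cont]) (auto simp: X \<open>0 \<le> b\<close> intro!: continuous_intros)
  then have "continuous_on X ?f"
    unfolding unit_cost_def case_prod_unfold by (intro continuous_intros)
  ultimately obtain x where x: "x \<in> X" "\<forall>y\<in>X. ?f y \<le> ?f x"
    using continuous_attains_sup[of X ?f] by blast
  then have "Sup (?f ` X) = ?f x"
    by (intro cSup_eq_maximum) auto
  moreover have "(\<lambda>(u, g). p * g - unit_cost c w (u, g)) = ?f"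
    by auto
  ultimately show ?thesis
    using x by auto
qed

lemma profit_attained:
  assumes "0 < gmax" "continuous_on {0..gmax} c"
  shows "\<exists>x\<in>feasible gmax. profit c w gmax p = p * snd x - unit_cost c w x
           \<and> (\<forall>y\<in>feasible gmax. p * snd y - unit_cost c w y \<le> p * snd x - unit_cost c w x)"
  unfolding profit_def using assms
  by (intro sup_attained[where b = gmax]) (auto simp: feasible_def)

lemma profit_hat_attained:
  assumes "0 < gmax" "0 \<le> d" "0 < e" "continuous_on {0..gmax} c"
  shows "\<exists>x\<in>feasible_hat d gmax e. profit_hat c w gmax d p e = p * snd x - unit_cost c w x
           \<and> (\<forall>y\<in>feasible_hat d gmax e.
                p * snd y - unit_cost c w y \<le> p * snd x - unit_cost c w x)"
  unfolding profit_hat_def using assms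
  by (intro sup_attained[where b = "min gmax (gbar d gmax + e)"])
     (auto simp: feasible_def feasible_hat_def gbar_def intro: continuous_on_subset)

end

theory Submission
  imports Defs
begin

text \<open>
  Let \<open>S\<close> be the set of prices at which relaxing the output cap of the economically viable
  units (those in \<open>breve_units\<close>) does not change their profit. The two dual functions agree on
  \<open>S\<close>, and the relaxed one is the smaller of the two everywhere. Both optimisation problems
  therefore have the same solutions and value once the larger dual function takes, at each
  price outside \<open>S\<close>, a value strictly below one of its values on \<open>S\<close>; this comparison principle
  is \<open>maximizers_and_SUP_eq_if_dominated\<close>.

  To see the strict domination, consider a viable unit whose cap \<open>b = d + e\<close>, with slack \<open>e > 0\<close>,
  lies below its capacity, and let \<open>s\<close> be a subgradient of its cost at \<open>b\<close>. The price \<open>s\<close> separates two regimes.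
  Below \<open>s\<close> producing more than \<open>b\<close> does not pay, so the cap does not matter
  (\<open>profit_hat_eq_profit_below_threshold\<close>). Above \<open>s\<close> every additional unit of output up to \<open>b\<close>
  at least pays for itself, and viability ensures that running at \<open>b\<close> also recovers the fixed cost
  \<open>w\<close>: if \<open>w > 0\<close>, the economic minimum output is at most \<open>d < b\<close> and minimises the average cost,
  and this minimal average cost is a marginal cost there, hence at most \<open>s\<close>. So the capped profit is the affine function
  \<open>p * b - c b - w\<close> (\<open>profit_hat_affine_above_threshold\<close>), of slope \<open>b > d\<close>.

  Let \<open>q\<close> be the least of these finitely many thresholds. All prices up to \<open>q\<close> belong to \<open>S\<close>.
  Beyond \<open>q\<close> a single unit already makes total profit grow faster than \<open>p * d\<close>, while the other
  profits do not decrease, so the dual function is strictly smaller there than at \<open>q\<close>.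
\<close>

section \<open>Comparison of two objective functions\<close>

text \<open>The suprema agree even if the functions are unbounded: two sets of reals with the same
  upper bounds have the same \<open>Sup\<close>, whatever its value.\<close>

lemma maximizers_and_SUP_eq_if_dominated:
  fixes f h :: "real \<Rightarrow> real"
  assumes le: "\<And>p. h p \<le> f p"
    and eq: "\<And>p. p \<in> S \<Longrightarrow> h p = f p"
    and dominated: "\<And>p. p \<notin> S \<Longrightarrow> \<exists>q\<in>S. f p < f q"
  shows "maximizers h = maximizers f" and "maximizers f \<subseteq> S" and "(SUP p. h p) = (SUP p. f p)"
proof -
  have lift: "\<exists>q. f p \<le> h q" for p
    using eq[of p] dominated[of p] eq by (metis less_imp_le order_refl)
  show sub: "maximizers f \<subseteq> S"
    using dominated unfolding maximizers_def by (fastforce simp: not_le[symmetric])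
  have "maximizers h \<subseteq> S"
  proof
    fix p assume p: "p \<in> maximizers h"
    show "p \<in> S"
    proof (rule ccontr)
      assume "p \<notin> S"
      then obtain q where "q \<in> S" "f p < f q"
        using dominated by blast
      then have "h p < h q"
        using le[of p] eq[of q] by linarith
      then show False
        using p unfolding maximizers_def by (auto simp: not_le[symmetric])
    qed
  qed
  show "maximizers h = maximizers f"
  proof (intro equalityI subsetI)
    fix p assume p: "p \<in> maximizers h"
    then have "h p = f p"
      using \<open>maximizers h \<subseteq> S\<close> eq by blast
    then show "p \<in> maximizers f"
      using p lift unfolding maximizers_def by (auto intro: order_trans) (metis order_trans)
  next
    fix p assume p: "p \<in> maximizers f"
    then have "h p = f p"
      using sub eq by blast
    then show "p \<in> maximizers h"
      using p le unfolding maximizers_def by (auto intro: order_trans)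
  qed
  have "(\<forall>p. h p \<le> z) \<longleftrightarrow> (\<forall>p. f p \<le> z)" for z
    using le lift order_trans by metis
  then show "(SUP p. h p) = (SUP p. f p)"
    unfolding Sup_real_def by simp
qed


section \<open>The economic minimum output\<close>

text \<open>The outputs satisfying \<open>is_ec_output\<close> are those minimising the average cost
  \<open>(w + c g) / g\<close>. Cleared of denominators, the condition is closed in \<open>g\<close> and makes sense on
  the whole of \<open>{0..gmax}\<close>.\<close>

lemma is_ec_output_iff_average_cost_minimal:
  "is_ec_output c w gmax g \<longleftrightarrow>
     g \<in> {0<..<gmax} \<and> (\<forall>y\<in>{0..gmax}. (w + c g) * y \<le> (w + c y) * g)"
proof -
  have "c g + (w + c g) / g * (y - g) \<le> c y \<longleftrightarrow> (w + c g) * y \<le> (w + c y) * g"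
    if "0 < g" for y
  proof -
    have "c g + (w + c g) / g * (y - g) = (w + c g) * y / g - w"
      using that by (simp add: field_simps)
    then show ?thesis
      using that by (simp add: field_simps)
  qed
  then show ?thesis
    unfolding is_ec_output_def subdifferential_def by auto
qed

text \<open>By compactness the \<open>LEAST\<close> in the definition of \<open>ec_min\<close> denotes an actual minimum. The
  endpoints of \<open>{0..gmax}\<close>, absent from \<open>is_ec_output\<close>, do not interfere: \<open>w > 0\<close> makes the average
  cost infinite at \<open>0\<close>, and \<open>gmax\<close> is not the least solution if there is one below it.\<close>

lemma is_ec_output_Least:
  assumes "0 < w" and cont: "continuous_on {0..gmax} c" and "c 0 = 0"
    and ex: "is_ec_output c w gmax g"
  shows "is_ec_output c w gmax (LEAST g. is_ec_output c w gmax g)"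
proof -
  define E where "E = {g \<in> {0..gmax}. \<forall>y\<in>{0..gmax}. (w + c g) * y \<le> (w + c y) * g}"
  have g: "g \<in> E" "0 < g" "g < gmax"
    using ex unfolding is_ec_output_iff_average_cost_minimal E_def by auto
  have "closed {g \<in> {0..gmax}. (w + c g) * y \<le> (w + c y) * g}" for y
    by (intro continuous_on_closed_Collect_le continuous_intros cont)
  then have "closed (\<Inter>y\<in>{0..gmax}. {g \<in> {0..gmax}. (w + c g) * y \<le> (w + c y) * g})"
    by blast
  moreover have "(\<Inter>y\<in>{0..gmax}. {g \<in> {0..gmax}. (w + c g) * y \<le> (w + c y) * g}) = E"
    using g(1) unfolding E_def by blast
  ultimately have "closed E"
    by simp
  moreover have "E = E \<inter> {0..gmax}"
    by (auto simp: E_def)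
  ultimately have "compact E"
    by (metis closed_Int_compact compact_Icc)
  then obtain m where m: "m \<in> E" "\<And>x. x \<in> E \<Longrightarrow> m \<le> x"
    using compact_attains_inf[of E] g by blast
  have "m \<noteq> 0"
    using m(1) assms(1,3) g by (auto simp: E_def mult_le_0_iff dest!: bspec[of _ _ gmax])
  moreover have "m < gmax"
    using m(2)[OF g(1)] g by simp
  ultimately have "is_ec_output c w gmax m"
    using m(1) unfolding is_ec_output_iff_average_cost_minimal E_def by auto
  moreover have "m \<le> x" if "is_ec_output c w gmax x" for x
    using that by (intro m(2)) (auto simp: is_ec_output_iff_average_cost_minimal E_def)
  ultimately show ?thesis
    by (metis (mono_tags, lifting) Least_equality)
qed

text \<open>Subgradients of a convex function are monotone. So beyond the economic minimum output,
  a marginal cost is no smaller than the minimal average cost, and a price equal to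
  this marginal cost recovers the fixed cost. If \<open>w = 0\<close>, the subgradient inequality at the
  output \<open>0\<close> already says so.\<close>

lemma fixed_cost_recovered_at_marginal_price:
  assumes "0 \<le> w" and cont: "continuous_on {0..gmax} c" and "c 0 = 0"
    and b: "0 < b" "b < gmax" "ec_min c w gmax < b"
    and s: "s \<in> subdifferential {0..gmax} c b"
  shows "c b + w \<le> s * b"
proof (cases "w = 0")
  case True
  have "c b + s * (0 - b) \<le> c 0"
    using s b unfolding subdifferential_def by (force dest: bspec[of _ _ 0])
  then show ?thesis
    using True \<open>c 0 = 0\<close> by simp
next
  case False
  then obtain g where "is_ec_output c w gmax g"
    using b unfolding ec_min_def by (auto split: if_splits)
  moreover define g0 where "g0 = ec_min c w gmax"
  ultimately have "is_ec_output c w gmax g0"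
    using is_ec_output_Least[of w gmax c g] assms(1-3) False unfolding ec_min_def by auto
  then have g0: "0 < g0" "g0 < b" "(w + c g0) * b \<le> (w + c b) * g0"
    using b unfolding is_ec_output_iff_average_cost_minimal g0_def by auto
  have "c b + s * (g0 - b) \<le> c g0"
    using s b g0 unfolding subdifferential_def by force
  then have "(w + c b + s * (g0 - b)) * b \<le> (w + c g0) * b"
    using b by (intro mult_right_mono) auto
  also note g0(3)
  finally have "(b - g0) * (c b + w) \<le> (b - g0) * (s * b)"
    by (simp add: algebra_simps)
  then show ?thesis
    using g0 by simp
qed

lemma subdifferential_nonempty_interior:
  assumes "convex_on {0..gmax} c" and "0 < b" "b < gmax"
  shows "\<exists>s. s \<in> subdifferential {0..gmax} c b"
proof -
  have "b \<in> interior {0..gmax}"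
    using assms by simp
  from convex_le_Inf_differential[OF assms(1) this] show ?thesis
    unfolding subdifferential_def by blast
qed


section \<open>The profit of a single unit\<close>

lemma profit_upper:
  assumes "0 < gmax" "continuous_on {0..gmax} c" "x \<in> feasible gmax"
  shows "p * snd x - unit_cost c w x \<le> profit c w gmax p"
  using profit_attained[OF assms(1,2), where p = p and w = w] assms(3) by auto

lemma profit_hat_upper:
  assumes "0 < gmax" "0 \<le> d" "0 < e" "continuous_on {0..gmax} c" "x \<in> feasible_hat d gmax e"
  shows "p * snd x - unit_cost c w x \<le> profit_hat c w gmax d p e"
  using profit_hat_attained[OF assms(1-4), where p = p and w = w] assms(5) by auto

lemma profit_hat_le_profit:
  assumes "0 < gmax" "0 \<le> d" "0 < e" "continuous_on {0..gmax} c"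
  shows "profit_hat c w gmax d p e \<le> profit c w gmax p"
  using profit_hat_attained[OF assms, where p = p and w = w]
    profit_upper[OF assms(1,4), where p = p and w = w]
  by (auto simp: feasible_hat_def)

lemma profit_hat_mono:
  assumes "0 < gmax" "0 \<le> d" "0 < e" "continuous_on {0..gmax} c" and "q \<le> p"
  shows "profit_hat c w gmax d q e \<le> profit_hat c w gmax d p e"
proof -
  obtain x where x: "x \<in> feasible_hat d gmax e"
    "profit_hat c w gmax d q e = q * snd x - unit_cost c w x"
    using profit_hat_attained[OF assms(1-4)] by blast
  then have "q * snd x \<le> p * snd x"
    using \<open>q \<le> p\<close> by (intro mult_right_mono) (auto simp: feasible_hat_def feasible_def)
  then show ?thesis
    using profit_hat_upper[OF assms(1-4) x(1), where p = p and w = w] x(2) by linarith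
qed

lemma profit_hat_eq_profit_if_cap_slack:
  assumes "0 < gmax" "gmax \<le> gbar d gmax + e"
  shows "profit_hat c w gmax d p e = profit c w gmax p"
proof -
  have "feasible_hat d gmax e = feasible gmax"
    using assms unfolding feasible_hat_def feasible_def by auto
  then show ?thesis
    by (simp add: profit_hat_def profit_def)
qed

text \<open>At a price \<open>p \<le> s\<close> the concave function \<open>p * g - c g\<close> does not increase beyond the cap,
  so cutting the output back to the cap costs nothing.\<close>

lemma profit_hat_eq_profit_below_threshold:
  assumes "0 < gmax" "0 \<le> d" "0 < e" and cont: "continuous_on {0..gmax} c"
    and b: "b = gbar d gmax + e" "b < gmax"
    and s: "s \<in> subdifferential {0..gmax} c b" and "p \<le> s"
  shows "profit_hat c w gmax d p e = profit c w gmax p"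
proof (rule antisym)
  show "profit_hat c w gmax d p e \<le> profit c w gmax p"
    by (rule profit_hat_le_profit[OF assms(1-4)])
  obtain u g where x: "(u, g) \<in> feasible gmax"
    "profit c w gmax p = p * g - unit_cost c w (u, g)"
    using profit_attained[OF assms(1) cont] by fastforce
  show "profit c w gmax p \<le> profit_hat c w gmax d p e"
  proof (cases "g \<le> b")
    case True
    then have "(u, g) \<in> feasible_hat d gmax e"
      using x b by (simp add: feasible_hat_def)
    from profit_hat_upper[OF assms(1-4) this, where p = p and w = w] show ?thesis
      using x by simp
  next
    case False
    moreover have "0 < b"
      using assms(1-3) b by (simp add: gbar_def min_def split: if_splits)
    ultimately have g: "u = 1" "b < g" "g \<le> gmax"
      using x by (auto simp: feasible_def)
    have "(1, b) \<in> feasible_hat d gmax e"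
      using b \<open>0 < b\<close> by (simp add: feasible_hat_def feasible_def)
    from profit_hat_upper[OF assms(1-4) this, where p = p and w = w]
    have "p * b - c b - w \<le> profit_hat c w gmax d p e"
      by (simp add: unit_cost_def)
    moreover have "c b + s * (g - b) \<le> c g"
      using s g \<open>0 < b\<close> unfolding subdifferential_def by force
    moreover have "p * (g - b) \<le> s * (g - b)"
      using \<open>p \<le> s\<close> g by (intro mult_right_mono) auto
    ultimately show ?thesis
      using x g by (simp add: unit_cost_def algebra_simps)
  qed
qed

text \<open>At a price \<open>p \<ge> s\<close> the function \<open>p * g - c g\<close> does not decrease up to the cap, so the
  cap itself is a best committed output. It yields no less than the zero profit of the decision
  \<open>(0, 0)\<close> because the cap exceeds the economic minimum output.\<close>

lemma profit_hat_affine_above_threshold: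
  assumes "0 < gmax" "0 \<le> d" "0 < e" and cont: "continuous_on {0..gmax} c"
    and "0 \<le> w" "c 0 = 0" and viable: "ec_min c w gmax \<le> gbar d gmax"
    and b: "b = gbar d gmax + e" "b < gmax"
    and s: "s \<in> subdifferential {0..gmax} c b" and "s \<le> p"
  shows "profit_hat c w gmax d p e = p * b - c b - w"
proof (rule antisym)
  have "0 < b"
    using assms(1-3) b by (simp add: gbar_def min_def split: if_splits)
  have "(1, b) \<in> feasible_hat d gmax e"
    using b \<open>0 < b\<close> by (simp add: feasible_hat_def feasible_def)
  from profit_hat_upper[OF assms(1-4) this, where p = p and w = w]
  show "p * b - c b - w \<le> profit_hat c w gmax d p e"
    by (simp add: unit_cost_def)
  obtain u g where x: "(u, g) \<in> feasible_hat d gmax e"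
    "profit_hat c w gmax d p e = p * g - unit_cost c w (u, g)"
    using profit_hat_attained[OF assms(1-4)] by fastforce
  then consider "u = 0" "g = 0" | "u = 1" "0 \<le> g" "g \<le> b"
    using b by (fastforce simp: feasible_hat_def feasible_def)
  then show "profit_hat c w gmax d p e \<le> p * b - c b - w"
  proof cases
    case 1
    have "c b + w \<le> s * b"
      using viable b \<open>0 < e\<close>
      by (intro fixed_cost_recovered_at_marginal_price[OF assms(5) cont assms(6) \<open>0 < b\<close> b(2) _ s])
        simp
    also have "\<dots> \<le> p * b"
      using \<open>s \<le> p\<close> \<open>0 < b\<close> by simp
    finally show ?thesis
      using x 1 \<open>c 0 = 0\<close> by (simp add: unit_cost_def)
  next
    case 2
    have "c b + s * (g - b) \<le> c g"
      using s 2 b unfolding subdifferential_def by force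
    moreover have "p * (g - b) \<le> s * (g - b)"
      using \<open>s \<le> p\<close> 2 by (intro mult_right_mono_neg) auto
    ultimately show ?thesis
      using x 2 by (simp add: unit_cost_def algebra_simps)
  qed
qed


section \<open>The relaxed dual problem\<close>

theorem proposition4:
  fixes I :: "'i set"
    and gmax w :: "'i \<Rightarrow> real"
    and c :: "'i \<Rightarrow> real \<Rightarrow> real"
    and d :: real
    and \<epsilon> :: "'i \<Rightarrow> real"
  assumes "finite I" and "I \<noteq> {}"
    and "\<And>i. i \<in> I \<Longrightarrow> gmax i > 0"
    and "\<And>i. i \<in> I \<Longrightarrow> w i \<ge> 0"
    and "\<And>i. i \<in> I \<Longrightarrow> mono_on {0..gmax i} (c i)"
    and "\<And>i. i \<in> I \<Longrightarrow> convex_on {0..gmax i} (c i)"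
    and "\<And>i. i \<in> I \<Longrightarrow> continuous_on {0..gmax i} (c i)"
    and "\<And>i. i \<in> I \<Longrightarrow> c i 0 = 0"
    and "0 \<le> d" and "d \<le> (\<Sum>i\<in>I. gmax i)"
    and "\<And>i. i \<in> I \<Longrightarrow> \<epsilon> i > 0"
  shows "P_breve I gmax w c d (restrict \<epsilon> (hat_units I gmax w c d)) = P_hat I gmax w c d \<epsilon>
    \<and> (\<forall>p\<in>P_hat I gmax w c d \<epsilon>. \<forall>i\<in>breve_units I gmax w c d.
         profit (c i) (w i) (gmax i) p = profit_hat (c i) (w i) (gmax i) d p (\<epsilon> i))
    \<and> nu_breve I gmax w c d (restrict \<epsilon> (hat_units I gmax w c d)) = nu_hat I gmax w c d \<epsilon>"
proof -
  define B where "B = breve_units I gmax w c d"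
  define H where "H = hat_units I gmax w c d"
  define f where "f = dual_hat I gmax w c d \<epsilon>"
  define h where "h = dual_breve I gmax w c d (restrict \<epsilon> H)"
  define \<pi> where "\<pi> i p = profit (c i) (w i) (gmax i) p" for i p
  define \<rho> where "\<rho> i p = profit_hat (c i) (w i) (gmax i) d p (\<epsilon> i)" for i p
  define S where "S = {p. \<forall>i\<in>B. \<pi> i p = \<rho> i p}"
  have BI: "B \<subseteq> I" and part: "I = B \<union> H" "B \<inter> H = {}"
    unfolding B_def H_def breve_units_def hat_units_def by auto
  have fin: "finite B" "finite H"
    using assms(1) part by (metis finite_Un)+
  have f_eq: "f p = p * d - (\<Sum>i\<in>I. \<rho> i p)" for p
    by (simp add: f_def dual_hat_def \<rho>_def)
  have h_eq: "h p = p * d - (\<Sum>i\<in>B. \<pi> i p) - (\<Sum>i\<in>H. \<rho> i p)" for p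
    by (simp add: h_def dual_breve_def \<pi>_def \<rho>_def B_def H_def)
  have f_split: "f p = p * d - (\<Sum>i\<in>B. \<rho> i p) - (\<Sum>i\<in>H. \<rho> i p)" for p
    using sum.union_disjoint[OF fin part(2), of "\<lambda>i. \<rho> i p"] part(1) by (simp add: f_eq)

  have le: "h p \<le> f p" for p
  proof -
    have "(\<Sum>i\<in>B. \<rho> i p) \<le> (\<Sum>i\<in>B. \<pi> i p)"
      unfolding \<pi>_def \<rho>_def using BI assms
      by (intro sum_mono profit_hat_le_profit) auto
    then show ?thesis
      by (simp add: h_eq f_split)
  qed
  have eq: "h p = f p" if "p \<in> S" for p
    using that by (simp add: h_eq f_split S_def)

  have dominated: "\<exists>q\<in>S. f p < f q" if "p \<notin> S" for p
  proof -
    \<comment> \<open>Only units whose cap lies below their capacity have a threshold price.\<close>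
    define T where "T = {i \<in> B. gbar d (gmax i) + \<epsilon> i < gmax i}"
    have T: "finite T" "T \<subseteq> B" "T \<subseteq> I"
      using fin BI by (auto simp: T_def)
    have cap_pos: "0 < gbar d (gmax i) + \<epsilon> i" if "i \<in> T" for i
      using that T assms(3,9,11) by (fastforce simp: gbar_def min_def)
    have "\<exists>s. s \<in> subdifferential {0..gmax i} (c i) (gbar d (gmax i) + \<epsilon> i)" if "i \<in> T" for i
      using that T assms(6) cap_pos by (intro subdifferential_nonempty_interior) (auto simp: T_def)
    then obtain t where
      t: "\<And>i. i \<in> T \<Longrightarrow> t i \<in> subdifferential {0..gmax i} (c i) (gbar d (gmax i) + \<epsilon> i)"
      by metis
    have below: "\<pi> i q = \<rho> i q" if "i \<in> B" "i \<in> T \<Longrightarrow> q \<le> t i" for i q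
    proof (cases "i \<in> T")
      case True
      then show ?thesis
        unfolding \<pi>_def \<rho>_def using that BI assms t
        by (intro profit_hat_eq_profit_below_threshold[symmetric, where s = "t i"])
          (auto simp: T_def)
    next
      case False
      then show ?thesis
        unfolding \<pi>_def \<rho>_def using that BI assms(3)
        by (intro profit_hat_eq_profit_if_cap_slack[symmetric]) (auto simp: T_def)
    qed
    obtain i where i: "i \<in> T" "t i < p"
      using \<open>p \<notin> S\<close> below unfolding S_def by (auto simp: not_le[symmetric])
    define q where "q = Min (t ` T)"
    have "q \<in> t ` T"
      unfolding q_def using T i by (intro Min_in) auto
    then obtain j where j: "j \<in> T" "q = t j"
      by blast
    have q_le: "q \<le> t k" if "k \<in> T" for k
      unfolding q_def using T that by simp
    then have "q < p"
      using i by fastforce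
    have "q \<in> S"
      unfolding S_def using below q_le by blast
    have affine: "\<rho> j r = r * (gbar d (gmax j) + \<epsilon> j) - c j (gbar d (gmax j) + \<epsilon> j) - w j"
      if "q \<le> r" for r
      unfolding \<rho>_def using that j T assms t
      by (intro profit_hat_affine_above_threshold[where s = "t j"])
        (auto simp: T_def B_def breve_units_def)
    have "\<rho> j p - \<rho> j q = (p - q) * (gbar d (gmax j) + \<epsilon> j)"
      using affine[of p] affine[of q] \<open>q < p\<close> by (simp add: algebra_simps)
    \<comment> \<open>The cap of \<open>j\<close> lies below its capacity, so that \<open>gbar d (gmax j)\<close> is \<open>d\<close>.\<close>
    moreover have "d < gbar d (gmax j) + \<epsilon> j"
      using j T assms(11)[of j] by (auto simp: T_def gbar_def min_def split: if_splits)
    ultimately have "(p - q) * d < \<rho> j p - \<rho> j q"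
      using \<open>q < p\<close> by simp
    moreover have "(\<Sum>k\<in>I - {j}. \<rho> k q) \<le> (\<Sum>k\<in>I - {j}. \<rho> k p)"
      unfolding \<rho>_def using assms \<open>q < p\<close> by (intro sum_mono profit_hat_mono) auto
    moreover have "(\<Sum>k\<in>I. \<rho> k r) = \<rho> j r + (\<Sum>k\<in>I - {j}. \<rho> k r)" for r
      using j T assms(1) by (intro sum.remove) auto
    ultimately have "f p < f q"
      by (simp add: f_eq algebra_simps)
    then show ?thesis
      using \<open>q \<in> S\<close> by blast
  qed

  note comparison = maximizers_and_SUP_eq_if_dominated[of h f S, OF le eq dominated]
  show ?thesis
    using comparison
    unfolding P_breve_def P_hat_def nu_breve_def nu_hat_def
      f_def h_def S_def H_def B_def \<pi>_def \<rho>_def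
    by blast
qed

end
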